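(* Let $\mathcal H$ be a complex Hilbert space with complex conjugation, $\eta\in\{-1,+1\}$, and let $S,\Sigma$ be commuting symmetry operators on $\mathcal H$ with $S^2=\eta\mathbf 1$ and $\Sigma^2=-\eta\mathbf 1$. Let $P$ be an orthogonal projection with $S^*\overline PS=\mathbf 1-P$ and $[\Sigma,P]=0$, and let $F$ be a unitary with $\Sigma^*F^t\Sigma=F$ and $[S,F]=0$, such that $T=PFP+\mathbf 1-P$ is Fredholm. Let $\Phi:\mathcal H_0\to\mathcal H$ be a Lagrangian frame with respect to $S$ with $P=\Phi\Phi^*$, and set $T_0=\Phi^*T\Phi=\Phi^*F\Phi\in\mathbb B(\mathcal H_0)$. Then, for an eigenvector $v\neq 0$, $$T_0^*T_0\,v=\lambda v,\qquad \lambda\ge0,$$ implies that $$w=\overline{(S\overline\Phi)^*\Sigma^*F\Phi\,v}$$ is linearly independent of $v$ and also satisfies $T_0^*T_0\,w=\lambda w$. Upon iteration one deduces that each eigenvalue of $T_0^*T_0$ has even degeneracy.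
   Context: A complex conjugation $\mathcal C$ is an anti-linear isometric map with $\mathcal C^2=\mathbf 1$. For operators (also between two Hilbert spaces with complex conjugations) $\overline A=\mathcal CA\mathcal C$ and $A^t=(\overline A)^*$; for vectors $\overline v=\mathcal Cv$. A symmetry operator is a real unitary ($\overline S=S$) squaring to $\mathbf 1$ or $-\mathbf 1$ with eigenspaces of the same dimension (the identity is also admitted). A Lagrangian frame with respect to $S$ is a linear map $\Phi:\mathcal H_0\to\mathcal H$ from an auxiliary Hilbert space $\mathcal H_0$ with complex conjugation satisfying $\Phi^*\Phi=\mathbf 1_{\mathcal H_0}$ and $\Phi\Phi^*+(S\overline\Phi)(S\overline\Phi)^*=\mathbf 1_{\mathcal H}$. $\mathbb B(\cdot)$ denotes the bounded operators.
   Formalization: The eigenvalue λ=1 is excluded from the linear independence and even degeneracy claims: there w=0 always, and degeneracy can be odd (H=C², Σ=1, F=1); even degeneracy is asserted for finite-dimensional eigenspaces. *)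

theory Defs
  imports "HOL-Analysis.Analysis"
begin

section \<open>Complex Hilbert spaces\<close>

class complex_vector = real_vector +
  fixes scaleC :: "complex \<Rightarrow> 'a \<Rightarrow> 'a" (infixr "*\<^sub>C" 75)
  assumes scaleC_add_right: "a *\<^sub>C (x + y) = a *\<^sub>C x + a *\<^sub>C y"
    and scaleC_add_left: "(a + b) *\<^sub>C x = a *\<^sub>C x + b *\<^sub>C x"
    and scaleC_scaleC: "a *\<^sub>C (b *\<^sub>C x) = (a * b) *\<^sub>C x"
    and scaleC_one: "1 *\<^sub>C x = x"
    and scaleR_scaleC: "r *\<^sub>R x = complex_of_real r *\<^sub>C x"

interpretation complex_vector: vector_space "scaleC :: complex \<Rightarrow> 'a \<Rightarrow> 'a::complex_vector"
  by unfold_locales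
    (simp_all add: scaleC_add_right scaleC_add_left scaleC_scaleC scaleC_one)

text \<open>The inner product is anti-linear in the first and linear in the second argument.\<close>

class complex_inner = complex_vector + real_normed_vector +
  fixes cinner :: "'a \<Rightarrow> 'a \<Rightarrow> complex"
  assumes cinner_commute: "cinner x y = cnj (cinner y x)"
    and cinner_add_right: "cinner x (y + z) = cinner x y + cinner x z"
    and cinner_scaleC_right: "cinner x (a *\<^sub>C y) = a * cinner x y"
    and norm_sq_cinner: "complex_of_real ((norm x)\<^sup>2) = cinner x x"

class chilbert_space = complex_inner + banach

section \<open>Bounded operators\<close>

definition bounded_clinear :: "('a::complex_inner \<Rightarrow> 'b::complex_inner) \<Rightarrow> bool" where
  "bounded_clinear A \<longleftrightarrow>
     Vector_Spaces.linear scaleC scaleC A \<and> (\<exists>K. \<forall>x. norm (A x) \<le> norm x * K)"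

text \<open>
  For bounded operators between Hilbert spaces the adjoint exists and is unique; for other
  functions the value is unspecified.
\<close>

definition cadjoint ::
  "('a::chilbert_space \<Rightarrow> 'b::chilbert_space) \<Rightarrow> 'b \<Rightarrow> 'a" where
  "cadjoint A = (SOME B. \<forall>x y. cinner (A x) y = cinner x (B y))"

definition unitary_op :: "('a::chilbert_space \<Rightarrow> 'a) \<Rightarrow> bool" where
  "unitary_op U \<longleftrightarrow> bounded_clinear U \<and> cadjoint U \<circ> U = id \<and> U \<circ> cadjoint U = id"

definition orthogonal_projection :: "('a::chilbert_space \<Rightarrow> 'a) \<Rightarrow> bool" where
  "orthogonal_projection P \<longleftrightarrow> bounded_clinear P \<and> P \<circ> P = P \<and> cadjoint P = P"

definition eigenspace :: "('a::complex_vector \<Rightarrow> 'a) \<Rightarrow> complex \<Rightarrow> 'a set" where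
  "eigenspace A \<mu> = {x. A x = \<mu> *\<^sub>C x}"

definition finite_cdim :: "'a::complex_vector set \<Rightarrow> bool" where
  "finite_cdim E \<longleftrightarrow> (\<exists>B. finite B \<and> E \<subseteq> complex_vector.span B)"

text \<open>Finite-dimensional kernel, closed range, finite-dimensional cokernel.\<close>

definition fredholm :: "('a::chilbert_space \<Rightarrow> 'b::chilbert_space) \<Rightarrow> bool" where
  "fredholm A \<longleftrightarrow> bounded_clinear A \<and> finite_cdim {x. A x = 0} \<and> closed (range A) \<and>
     (\<exists>B. finite B \<and> complex_vector.span (range A \<union> B) = UNIV)"

section \<open>Complex conjugations\<close>

definition complex_conjugation :: "('a::complex_inner \<Rightarrow> 'a) \<Rightarrow> bool" where
  "complex_conjugation C \<longleftrightarrow>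
     (\<forall>x y. C (x + y) = C x + C y) \<and> (\<forall>a x. C (a *\<^sub>C x) = cnj a *\<^sub>C C x) \<and>
     (\<forall>x. norm (C x) = norm x) \<and> C \<circ> C = id"

definition op_conj :: "('a \<Rightarrow> 'a) \<Rightarrow> ('b \<Rightarrow> 'b) \<Rightarrow> ('a \<Rightarrow> 'b) \<Rightarrow> ('a \<Rightarrow> 'b)" where
  "op_conj C1 C2 A = C2 \<circ> A \<circ> C1"

definition op_transpose ::
  "('a::chilbert_space \<Rightarrow> 'a) \<Rightarrow> ('b::chilbert_space \<Rightarrow> 'b) \<Rightarrow> ('a \<Rightarrow> 'b) \<Rightarrow> ('b \<Rightarrow> 'a)" where
  "op_transpose C1 C2 A = cadjoint (op_conj C1 C2 A)"

section \<open>Symmetry operators\<close>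

definition orthonormal_basis_of :: "'a::complex_inner set \<Rightarrow> 'a set \<Rightarrow> bool" where
  "orthonormal_basis_of B E \<longleftrightarrow> B \<subseteq> E \<and>
     (\<forall>x\<in>B. \<forall>y\<in>B. cinner x y = (if x = y then 1 else 0)) \<and>
     E \<subseteq> closure (complex_vector.span B)"

text \<open>Equality of Hilbert space dimensions, as cardinals, of two closed subspaces.\<close>

definition same_hilbert_dim :: "'a::complex_inner set \<Rightarrow> 'b::complex_inner set \<Rightarrow> bool" where
  "same_hilbert_dim E E' \<longleftrightarrow>
     (\<exists>B B' f. orthonormal_basis_of B E \<and> orthonormal_basis_of B' E' \<and> bij_betw f B B')"

definition symmetry_op :: "('a::chilbert_space \<Rightarrow> 'a) \<Rightarrow> ('a \<Rightarrow> 'a) \<Rightarrow> bool" where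
  "symmetry_op C S \<longleftrightarrow> unitary_op S \<and> op_conj C C S = S \<and>
     (S = id \<or>
      (S \<circ> S = id \<and> same_hilbert_dim (eigenspace S 1) (eigenspace S (- 1))) \<or>
      (S \<circ> S = (\<lambda>x. - x) \<and> same_hilbert_dim (eigenspace S \<i>) (eigenspace S (- \<i>))))"

definition lagrangian_frame ::
  "('a::chilbert_space \<Rightarrow> 'a) \<Rightarrow> ('b::chilbert_space \<Rightarrow> 'b) \<Rightarrow> ('b \<Rightarrow> 'b) \<Rightarrow> ('a \<Rightarrow> 'b) \<Rightarrow> bool"
where
  "lagrangian_frame C0 C S \<Phi> \<longleftrightarrow> bounded_clinear \<Phi> \<and> cadjoint \<Phi> \<circ> \<Phi> = id \<and>
     (\<forall>x. \<Phi> (cadjoint \<Phi> x) +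
          (S \<circ> op_conj C0 C \<Phi>) (cadjoint (S \<circ> op_conj C0 C \<Phi>) x) = x)"

end

theory Submission
  imports Defs
begin

text \<open>
  Let \<open>J v\<close> be the partner \<open>w\<close> of \<open>v\<close>. The map \<open>J\<close> is antilinear, and the symmetries
  together with \<open>S\<^sup>2 = \<eta>\<close>, \<open>\<Sigma>\<^sup>2 = - \<eta>\<close> make the form \<open>cinner x (J y)\<close> antisymmetric. As
  \<open>\<Phi>\<close> and \<open>S \<circ> op_conj C0 C \<Phi>\<close> have complementary ranges, antisymmetry turns into
  \<open>J (J v) = T0\<^sup>* T0 v - v\<close>. Hence \<open>J\<close> commutes with \<open>T0\<^sup>* T0\<close>, and on an eigenspace with
  eigenvalue \<open>l \<noteq> 1\<close> (so \<open>l < 1\<close>) its square is the negative scalar \<open>l - 1\<close>: \<open>J\<close> is a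
  quaternionic structure up to scaling, which forces the dimension to be even.
\<close>

section \<open>Inner products\<close>

lemma cinner_add_left: "cinner (x + y) z = cinner x z + cinner y z"
  for x :: "'a::complex_inner"
  by (metis cinner_add_right cinner_commute complex_cnj_add)

lemma cinner_scaleC_left: "cinner (a *\<^sub>C x) y = cnj a * cinner x y"
  for x :: "'a::complex_inner"
  by (metis cinner_commute cinner_scaleC_right complex_cnj_mult)

lemma cinner_scaleR_left: "cinner (r *\<^sub>R x) y = of_real r * cinner x y"
  for x :: "'a::complex_inner"
  by (simp add: scaleR_scaleC cinner_scaleC_left)

lemma cinner_scaleR_right: "cinner x (r *\<^sub>R y) = of_real r * cinner x y"
  for x :: "'a::complex_inner"
  by (simp add: scaleR_scaleC cinner_scaleC_right)

lemma cinner_minus_right: "cinner x (- y) = - cinner x y"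
  for x :: "'a::complex_inner"
  using cinner_scaleR_right[of x "- 1" y] by simp

lemma cinner_minus_left: "cinner (- x) y = - cinner x y"
  for x :: "'a::complex_inner"
  using cinner_scaleR_left[of "- 1" x y] by simp

lemma cinner_diff_right: "cinner x (y - z) = cinner x y - cinner x z"
  for x :: "'a::complex_inner"
  using cinner_add_right[of x y "- z"] by (simp add: cinner_minus_right)

lemma cinner_eq_zero_iff: "cinner x x = 0 \<longleftrightarrow> x = 0"
  for x :: "'a::complex_inner"
  using norm_sq_cinner[of x] by (metis norm_eq_zero of_real_eq_0_iff power2_eq_square mult_eq_0_iff)

lemma cinner_eqI: "(\<And>x. cinner x y = cinner x z) \<Longrightarrow> y = z"
  for y :: "'a::complex_inner"
  by (metis cinner_diff_right cinner_eq_zero_iff eq_iff_diff_eq_0)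

lemma Re_cinner_commute: "Re (cinner x y) = Re (cinner y x)"
  for x :: "'a::complex_inner"
  using cinner_commute[of x y] by simp

lemma Re_cinner_self: "Re (cinner x x) = (norm x)\<^sup>2"
  for x :: "'a::complex_inner"
  by (simp flip: norm_sq_cinner)

lemma norm_add_sq: "(norm (x + y))\<^sup>2 = (norm x)\<^sup>2 + 2 * Re (cinner x y) + (norm y)\<^sup>2"
  for x :: "'a::complex_inner"
  using Re_cinner_self[of "x + y"] Re_cinner_commute[of x y]
  by (simp add: cinner_add_left cinner_add_right Re_cinner_self)

text \<open>The triangle inequality already belongs to the norm of the class, so squaring it and
  comparing cross terms gives Cauchy-Schwarz for real parts.\<close>

lemma Re_cinner_le: "Re (cinner x y) \<le> norm x * norm y"
  for x :: "'a::complex_inner"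
proof -
  have "(norm (x + y))\<^sup>2 \<le> (norm x + norm y)\<^sup>2"
    by (simp add: norm_triangle_ineq power_mono)
  then show ?thesis
    by (simp add: norm_add_sq power2_sum)
qed

lemma abs_Re_cinner_le: "\<bar>Re (cinner x y)\<bar> \<le> norm x * norm y"
  for x :: "'a::complex_inner"
  using Re_cinner_le[of x y] Re_cinner_le[of "- x" y] by (simp add: cinner_minus_left)

lemma parallelogram_law:
  "(norm (x + y))\<^sup>2 + (norm (x - y))\<^sup>2 = 2 * (norm x)\<^sup>2 + 2 * (norm y)\<^sup>2"
  for x :: "'a::complex_inner"
  using norm_add_sq[of x y] norm_add_sq[of x "- y"] by (simp add: cinner_minus_right)

section \<open>Riesz representation and adjoints\<close>

text \<open>The representing vector is the minimiser of \<open>(norm x)\<^sup>2 - 2 * f x\<close>;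
  minimising sequences are Cauchy by the parallelogram law.\<close>

lemma riesz_representation_Re:
  fixes f :: "'a::chilbert_space \<Rightarrow> real"
  assumes f: "bounded_linear f"
  obtains z where "\<And>y. f y = Re (cinner z y)"
proof -
  interpret bounded_linear f by (rule f)
  obtain K where K: "\<And>x. \<bar>f x\<bar> \<le> norm x * K"
    using bounded by auto
  define G where "G x = (norm x)\<^sup>2 - 2 * f x" for x
  \<comment> \<open>Completing the square: \<open>G x\<close> is at least
    \<open>(norm x - K)\<^sup>2 - K\<^sup>2\<close>.\<close>
  have "- K\<^sup>2 \<le> G x" for x
  proof -
    have "0 \<le> (norm x - K)\<^sup>2" by simp
    with K[of x] show ?thesis by (simp add: G_def power2_diff)
  qed
  then have bdd: "bdd_below (range G)" by (auto intro!: bdd_belowI2[of _ "- K\<^sup>2"])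
  define m where "m = (INF x. G x)"
  have m_le: "m \<le> G x" for x
    unfolding m_def by (rule cINF_lower[OF bdd]) simp
  have "\<exists>x. G x < m + 1 / real (Suc n)" for n
    using cINF_less_iff[OF _ bdd, of "m + 1 / real (Suc n)"] by (simp add: m_def)
  then obtain X where X: "\<And>n. G (X n) < m + 1 / real (Suc n)" by metis
  \<comment> \<open>By the parallelogram law the left side equals \<open>2 * G x + 2 * G y\<close>
    minus four times \<open>G\<close> at the midpoint, and \<open>G\<close> is at least
    \<open>m\<close> there.\<close>
  have gap: "(norm (x - y))\<^sup>2 \<le> 2 * (G x - m) + 2 * (G y - m)" for x y
  proof -
    have "4 * G ((1/2) *\<^sub>R (x + y)) = (norm (x + y))\<^sup>2 - 4 * (f x + f y)"
      by (simp add: G_def scaleR add power_divide) (simp add: field_simps)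
    with m_le[of "(1/2) *\<^sub>R (x + y)"] parallelogram_law[of x y] show ?thesis
      by (simp add: G_def)
  qed
  have "Cauchy X"
  proof (rule metric_CauchyI)
    fix e :: real
    assume "0 < e"
    then obtain N where N: "inverse (real (Suc N)) < e\<^sup>2 / 4"
      using reals_Archimedean[of "e\<^sup>2 / 4"] by auto
    have small: "G (X n) - m < e\<^sup>2 / 4" if "N \<le> n" for n
    proof -
      have "1 / real (Suc n) \<le> 1 / real (Suc N)"
        using that by (intro divide_left_mono) auto
      with X[of n] N show ?thesis by (simp add: inverse_eq_divide)
    qed
    have "dist (X i) (X j) < e" if "N \<le> i" "N \<le> j" for i j
    proof -
      note gap[of "X i" "X j"]
      also have "2 * (G (X i) - m) + 2 * (G (X j) - m) < 2 * (e\<^sup>2 / 4) + 2 * (e\<^sup>2 / 4)"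
        by (intro add_strict_mono mult_strict_left_mono small that) simp_all
      finally have "(norm (X i - X j))\<^sup>2 < e\<^sup>2" by simp
      with \<open>0 < e\<close> show ?thesis
        by (simp add: dist_norm power2_less_imp_less)
    qed
    then show "\<exists>M. \<forall>i\<ge>M. \<forall>j\<ge>M. dist (X i) (X j) < e" by blast
  qed
  then obtain z where z: "X \<longlonglongrightarrow> z"
    using Cauchy_convergent convergent_def by blast
  have "(\<lambda>n. G (X n)) \<longlonglongrightarrow> G z"
    unfolding G_def by (intro tendsto_intros tendsto z)
  moreover have "(\<lambda>n. m + 1 / real (Suc n)) \<longlonglongrightarrow> m"
    using tendsto_add[OF tendsto_const LIMSEQ_inverse_real_of_nat, of m]
    by (simp add: inverse_eq_divide)
  ultimately have "G z \<le> m"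
    using X by (intro LIMSEQ_le[of "\<lambda>n. G (X n)"]) (auto intro: less_imp_le)
  have "Re (cinner z y) - f y = 0" for y
  proof -
    define d where "d = Re (cinner z y) - f y"
    have quad: "0 \<le> 2 * t * d + t\<^sup>2 * (norm y)\<^sup>2" for t :: real
    proof -
      have "G z \<le> G (z + t *\<^sub>R y)"
        using \<open>G z \<le> m\<close> m_le order_trans by blast
      then show ?thesis
        by (simp add: G_def d_def norm_add_sq cinner_scaleR_right add scaleR
            power_mult_distrib algebra_simps)
    qed
    \<comment> \<open>The step \<open>- d / b\<close> nearly minimises the quadratic in
      \<open>t\<close> and yields \<open>- d\<^sup>2 / b\<close>; adding 1 keeps the denominator
      positive when \<open>y = 0\<close>.\<close>
    define b where "b = (norm y)\<^sup>2 + 1"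
    have b: "0 < b" "(norm y)\<^sup>2 \<le> b" by (simp_all add: b_def add_nonneg_pos)
    have "0 \<le> 2 * (- d / b) * d + (- d / b)\<^sup>2 * b"
      using quad[of "- d / b"] mult_left_mono[OF b(2), of "(- d / b)\<^sup>2"] by simp
    then have "d\<^sup>2 / b \<le> 0"
      using b(1) by (simp add: power2_eq_square field_simps)
    with b(1) have "d = 0"
      by (simp add: divide_le_0_iff)
    then show ?thesis by (simp add: d_def)
  qed
  then show ?thesis by (intro that[of z]) simp
qed

section \<open>Algebra of bounded complex-linear maps\<close>

lemma bounded_clinear_add: "bounded_clinear A \<Longrightarrow> A (x + y) = A x + A y"
  unfolding bounded_clinear_def
  using module_hom.add linear_iff_module_hom by blast

lemma bounded_clinear_scaleC: "bounded_clinear A \<Longrightarrow> A (a *\<^sub>C x) = a *\<^sub>C A x"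
  unfolding bounded_clinear_def
  using module_hom.scale linear_iff_module_hom by blast

lemma bounded_clinear_scaleR: "bounded_clinear A \<Longrightarrow> A (r *\<^sub>R x) = r *\<^sub>R A x"
  by (simp add: scaleR_scaleC bounded_clinear_scaleC)

lemma bounded_clinear_diff: "bounded_clinear A \<Longrightarrow> A (x - y) = A x - A y"
  using bounded_clinear_add[of A x "- y"] bounded_clinear_scaleR[of A "- 1" y] by simp

lemma bounded_clinearI:
  assumes "\<And>x y. A (x + y) = A x + A y" "\<And>a x. A (a *\<^sub>C x) = a *\<^sub>C A x"
    and "\<And>x. norm (A x) \<le> norm x * K"
  shows "bounded_clinear A"
  unfolding bounded_clinear_def
  using assms by (auto intro!: Vector_Spaces.linear.intro module_hom.intro
      module_hom_axioms.intro complex_vector.vector_space_axioms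
      complex_vector.module_axioms simp: linear_iff_module_hom)

lemma bounded_clinear_compose:
  assumes "bounded_clinear A" "bounded_clinear B"
  shows "bounded_clinear (A \<circ> B)"
proof -
  obtain K where K: "\<And>x. norm (A x) \<le> norm x * K"
    using assms(1) unfolding bounded_clinear_def by blast
  obtain L where L: "\<And>x. norm (B x) \<le> norm x * L"
    using assms(2) unfolding bounded_clinear_def by blast
  have "norm (A (B x)) \<le> norm x * (\<bar>L\<bar> * \<bar>K\<bar>)" for x
  proof -
    have "norm (A (B x)) \<le> norm (B x) * \<bar>K\<bar>"
      by (rule order_trans[OF K]) (simp add: mult_left_mono)
    also have "\<dots> \<le> norm x * \<bar>L\<bar> * \<bar>K\<bar>"
      by (intro mult_right_mono order_trans[OF L] mult_left_mono) simp_all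
    finally show ?thesis
      by (simp add: mult.assoc)
  qed
  then show ?thesis
    by (intro bounded_clinearI[where K = "\<bar>L\<bar> * \<bar>K\<bar>"])
      (simp_all add: assms bounded_clinear_add bounded_clinear_scaleC)
qed

lemma subspace_eigenspace:
  assumes "bounded_clinear A"
  shows "complex_vector.subspace (eigenspace A \<mu>)"
  using bounded_clinear_scaleC[OF assms, of 0]
  by (intro complex_vector.subspaceI)
    (auto simp: eigenspace_def assms bounded_clinear_add bounded_clinear_scaleC
      scaleC_add_right scaleC_scaleC mult.commute)

section \<open>Existence and properties of adjoints\<close>

text \<open>The real Riesz theorem represents the real part of \<open>cinner y (A x)\<close>;
  replacing \<open>x\<close> by \<open>\<i> *\<^sub>C x\<close> shows that the same vector
  represents the imaginary part.\<close>

lemma cadjoint_exists: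
  fixes A :: "'a::chilbert_space \<Rightarrow> 'b::chilbert_space"
  assumes A: "bounded_clinear A"
  shows "\<exists>B. \<forall>x y. cinner (A x) y = cinner x (B y)"
proof -
  obtain K where K: "\<And>x. norm (A x) \<le> norm x * K"
    using A unfolding bounded_clinear_def by blast
  have "\<exists>z. \<forall>x. cinner (A x) y = cinner x z" for y
  proof -
    have "bounded_linear (\<lambda>x. Re (cinner y (A x)))"
    proof (rule bounded_linear_intro[where K = "norm y * K"])
      fix x
      have "\<bar>Re (cinner y (A x))\<bar> \<le> norm y * (norm x * K)"
        using abs_Re_cinner_le[of y "A x"] mult_left_mono[OF K[of x], of "norm y"] by simp
      then show "norm (Re (cinner y (A x))) \<le> norm x * (norm y * K)"
        by (simp add: mult_ac)
    qed (simp_all add: A bounded_clinear_add bounded_clinear_scaleR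
        cinner_add_right cinner_scaleR_right)
    then obtain z where z: "\<And>x. Re (cinner y (A x)) = Re (cinner z x)"
      using riesz_representation_Re by blast
    have "cinner y (A x) = cinner z x" for x
      using z[of x] z[of "\<i> *\<^sub>C x"]
      by (intro complex_eqI) (simp_all add: A bounded_clinear_scaleC cinner_scaleC_right)
    then show ?thesis
      by (metis cinner_commute)
  qed
  then show ?thesis by metis
qed

lemma cinner_cadjoint_right:
  assumes "bounded_clinear A"
  shows "cinner (A x) y = cinner x (cadjoint A y)"
  using someI_ex[OF cadjoint_exists[OF assms]] unfolding cadjoint_def by blast

lemma cinner_cadjoint_left:
  assumes "bounded_clinear A"
  shows "cinner (cadjoint A y) x = cinner y (A x)"
  by (metis assms cinner_cadjoint_right cinner_commute)

text \<open>Linearity follows by testing against all vectors. For the bound, Cauchy-Schwarz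
  estimates the square of \<open>norm (cadjoint A y)\<close> by that norm times
  \<open>norm y * K\<close>, and one factor is divided out.\<close>

lemma bounded_clinear_cadjoint:
  assumes A: "bounded_clinear A"
  shows "bounded_clinear (cadjoint A)"
proof -
  obtain K where K: "\<And>x. norm (A x) \<le> norm x * K"
    using A unfolding bounded_clinear_def by blast
  have "norm (cadjoint A y) \<le> norm y * \<bar>K\<bar>" for y
  proof (cases "cadjoint A y = 0")
    case False
    have "(norm (cadjoint A y))\<^sup>2 = Re (cinner y (A (cadjoint A y)))"
      by (simp add: A cinner_cadjoint_left flip: Re_cinner_self)
    also have "\<dots> \<le> norm y * (norm (cadjoint A y) * K)"
      by (rule order_trans[OF Re_cinner_le]) (simp add: K mult_left_mono)
    finally have "norm (cadjoint A y) \<le> norm y * K"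
      using False by (simp add: power2_eq_square mult_ac)
    then show ?thesis
      by (rule order_trans) (simp add: mult_left_mono)
  qed simp
  then show ?thesis
    by (intro bounded_clinearI cinner_eqI)
      (simp_all add: A cinner_add_right cinner_scaleC_right flip: cinner_cadjoint_right)
qed

lemma cinner_unitary:
  assumes "unitary_op U"
  shows "cinner (U x) (U y) = cinner x y"
proof -
  have "cadjoint U (U y) = y" for y
    using assms unfolding unitary_op_def by (metis comp_apply id_apply)
  then show ?thesis
    using assms by (simp add: unitary_op_def cinner_cadjoint_right)
qed

section \<open>Complex conjugations\<close>

text \<open>Polarisation: the norm of a sum determines the real part of the inner product, and this
  uses only additivity.\<close>

lemma Re_cinner_eq_if_isometric:
  assumes "\<And>x y. C (x + y) = C x + C y" "\<And>x. norm (C x) = norm x"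
  shows "Re (cinner (C x) (C y)) = Re (cinner x y)"
  using norm_add_sq[of x y] norm_add_sq[of "C x" "C y"] assms(2)[of "x + y"]
  by (simp add: assms)

text \<open>Real parts are preserved by polarisation. Imaginary parts are real parts against
  \<open>\<i> *\<^sub>C y\<close>, where antilinearity flips the sign; conjugating the value swaps
  the arguments.\<close>

lemma cinner_complex_conjugation:
  assumes "complex_conjugation C"
  shows "cinner (C x) (C y) = cinner y x"
proof -
  have Re: "Re (cinner (C x) (C y)) = Re (cinner x y)" for x y
    using assms by (intro Re_cinner_eq_if_isometric) (simp_all add: complex_conjugation_def)
  have "C (\<i> *\<^sub>C y) = (- \<i>) *\<^sub>C C y"
    using assms by (simp add: complex_conjugation_def)
  then have "Im (cinner (C x) (C y)) = - Im (cinner x y)"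
    using Re[of x "\<i> *\<^sub>C y"] by (simp add: cinner_scaleC_right cinner_minus_right)
  with Re[of x y] have "cinner (C x) (C y) = cnj (cinner x y)"
    by (simp add: complex_eq_iff)
  then show ?thesis
    by (metis cinner_commute)
qed

lemma bounded_clinear_op_conj:
  assumes C1: "complex_conjugation C1" and C2: "complex_conjugation C2"
    and A: "bounded_clinear A"
  shows "bounded_clinear (op_conj C1 C2 A)"
proof -
  obtain K where K: "\<And>x. norm (A x) \<le> norm x * K"
    using A unfolding bounded_clinear_def by blast
  have "norm (op_conj C1 C2 A x) \<le> norm x * K" for x
    using K[of "C1 x"] C1 C2 by (simp add: complex_conjugation_def op_conj_def)
  with C1 C2 show ?thesis
    by (intro bounded_clinearI)
      (simp_all add: complex_conjugation_def op_conj_def A bounded_clinear_add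
        bounded_clinear_scaleC)
qed

section \<open>Quaternionic structures\<close>

text \<open>If \<open>J v = a *\<^sub>C v\<close>, antilinearity turns the second application into
  the scalar \<open>cnj a * a\<close>, which is nonnegative and so cannot equal
  \<open>- c\<close>.\<close>

lemma antilinear_square_no_eigenvector:
  fixes v :: "'a::complex_vector"
  assumes scale: "\<And>a x. J (a *\<^sub>C x) = cnj a *\<^sub>C J x"
    and J: "J (J v) = - (c *\<^sub>R v)" and c: "0 < c" and v: "v \<noteq> 0"
  shows "J v \<noteq> a *\<^sub>C v"
proof
  assume *: "J v = a *\<^sub>C v"
  have "J (J v) = (cnj a * a) *\<^sub>C v"
    by (simp add: * scale scaleC_scaleC)
  also have "cnj a * a = complex_of_real ((cmod a)\<^sup>2)"
    by (metis complex_norm_square mult.commute)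
  also have "\<dots> *\<^sub>C v = (cmod a)\<^sup>2 *\<^sub>R v"
    by (simp only: scaleR_scaleC)
  finally have "(c + (cmod a)\<^sup>2) *\<^sub>R v = c *\<^sub>R v + J (J v)"
    by (simp add: scaleR_add_left)
  then have "(c + (cmod a)\<^sup>2) *\<^sub>R v = 0"
    by (simp add: J)
  moreover have "c + (cmod a)\<^sup>2 \<noteq> 0"
    using c by (simp add: add_pos_nonneg less_imp_neq[symmetric])
  ultimately show False
    using v by simp
qed

text \<open>A maximal linearly independent set of even size with \<open>J\<close>-invariant span must span \<open>E\<close>:
  otherwise adjoin \<open>v, J v\<close> for some \<open>v\<close> in \<open>E\<close> outside its span.\<close>

lemma even_dim_if_quaternionic:
  fixes J :: "'a::complex_vector \<Rightarrow> 'a"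
  assumes add: "\<And>x y. J (x + y) = J x + J y"
    and scale: "\<And>a x. J (a *\<^sub>C x) = cnj a *\<^sub>C J x"
    and E: "complex_vector.subspace E" and fin: "finite_cdim E"
    and JE: "\<And>x. x \<in> E \<Longrightarrow> J x \<in> E"
    and JJ: "\<And>x. x \<in> E \<Longrightarrow> J (J x) = - (c *\<^sub>R x)" and c: "0 < c"
  shows "even (complex_vector.dim E)"
proof -
  let ?span = "complex_vector.span :: 'a set \<Rightarrow> 'a set"
  let ?indep = "complex_vector.independent :: 'a set \<Rightarrow> bool"
  obtain B0 :: "'a set" where B0: "finite B0" "E \<subseteq> ?span B0"
    using fin unfolding finite_cdim_def by blast
  \<comment> \<open>\<open>Q\<close> collects the sizes of the admissible sets. They are bounded by
    the size of a finite spanning set, so a greatest one exists.\<close>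
  define Q where "Q n \<longleftrightarrow> (\<exists>B. finite B \<and> B \<subseteq> E \<and> ?indep B \<and> even (card B) \<and>
      J ` ?span B \<subseteq> ?span B \<and> card B = n)" for n
  have J0: "J 0 = 0"
    using add[of 0 0] by simp
  have "Q 0"
    unfolding Q_def using J0
    by (intro exI[of _ "{}"]) (simp add: complex_vector.independent_empty)
  moreover have bound: "n \<le> card B0" if "Q n" for n
    using that unfolding Q_def using complex_vector.independent_span_bound[OF B0(1)] B0(2) by blast
  ultimately obtain n where n: "Q n" and max: "\<And>m. Q m \<Longrightarrow> m \<le> n"
    using GreatestI_nat[of Q] Greatest_le_nat[of Q] by blast
  obtain B where B: "finite B" "B \<subseteq> E" "?indep B" "even (card B)" "card B = n"
    and JB: "\<And>x. x \<in> ?span B \<Longrightarrow> J x \<in> ?span B"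
    using n unfolding Q_def by blast
  have "E \<subseteq> ?span B"
  proof (rule ccontr)
    assume "\<not> E \<subseteq> ?span B"
    then obtain v where v: "v \<in> E" "v \<notin> ?span B" by blast
    \<comment> \<open>If \<open>J v = w + a *\<^sub>C v\<close> with \<open>w\<close> in the span of
      \<open>B\<close>, applying \<open>J\<close> again puts \<open>c + (cmod a)\<^sup>2\<close>
      times \<open>v\<close> into that span. This factor is positive, so \<open>v\<close> itself
      would lie there.\<close>
    have Jv: "J v \<notin> ?span (insert v B)"
    proof
      assume "J v \<in> ?span (insert v B)"
      then obtain a where a: "J v - a *\<^sub>C v \<in> ?span B"
        unfolding complex_vector.span_insert by blast
      define w where "w = J v - a *\<^sub>C v"
      have w: "w \<in> ?span B" "J v = w + a *\<^sub>C v"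
        using a by (simp_all add: w_def)
      have "J (J v) = J w + cnj a *\<^sub>C w + (cnj a * a) *\<^sub>C v"
        by (simp add: w(2) add scale scaleC_add_right scaleC_scaleC add.assoc)
      also have "cnj a * a = complex_of_real ((cmod a)\<^sup>2)"
        by (metis complex_norm_square mult.commute)
      finally have "- (c *\<^sub>R v) = J w + cnj a *\<^sub>C w + (cmod a)\<^sup>2 *\<^sub>R v"
        using JJ[OF v(1)] by (simp only: scaleR_scaleC)
      then have "(c + (cmod a)\<^sup>2) *\<^sub>R v = - (J w + cnj a *\<^sub>C w)"
        by (simp add: scaleR_add_left algebra_simps eq_neg_iff_add_eq_0 neg_eq_iff_add_eq_0)
      moreover have "- (J w + cnj a *\<^sub>C w) \<in> ?span B"
        by (intro complex_vector.span_neg complex_vector.span_add complex_vector.span_scale JB w)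
      ultimately have "(c + (cmod a)\<^sup>2) *\<^sub>R v \<in> ?span B"
        by simp
      then have "complex_of_real (inverse (c + (cmod a)\<^sup>2)) *\<^sub>C (c + (cmod a)\<^sup>2) *\<^sub>R v \<in> ?span B"
        by (rule complex_vector.span_scale)
      moreover have "c + (cmod a)\<^sup>2 \<noteq> 0"
        using c by (simp add: add_pos_nonneg less_imp_neq[symmetric])
      then have "complex_of_real (inverse (c + (cmod a)\<^sup>2)) *\<^sub>C (c + (cmod a)\<^sup>2) *\<^sub>R v = v"
        unfolding scaleR_scaleC[symmetric] by simp
      ultimately show False
        using v(2) by simp
    qed
    let ?B = "insert (J v) (insert v B)"
    have notin: "v \<notin> B" "J v \<notin> insert v B"
      using v(2) Jv complex_vector.span_superset by blast+
    have card: "card ?B = n + 2"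
      using notin B by simp
    have "?indep ?B"
      using v(2) Jv B(3) by (simp add: complex_vector.independent_insertI)
    moreover have "J x \<in> ?span ?B" if x: "x \<in> ?span ?B" for x
    proof -
      obtain a b where ab: "x - a *\<^sub>C J v - b *\<^sub>C v \<in> ?span B"
        using x unfolding complex_vector.span_breakdown_eq by blast
      define w where "w = x - a *\<^sub>C J v - b *\<^sub>C v"
      have x_eq: "x = w + a *\<^sub>C J v + b *\<^sub>C v"
        by (simp add: w_def)
      have "J w \<in> ?span ?B"
        using JB ab complex_vector.span_mono[of B ?B] unfolding w_def by blast
      moreover have "J v \<in> ?span ?B" "v \<in> ?span ?B"
        by (auto intro: complex_vector.span_base)
      moreover have "J (J v) \<in> ?span ?B"
        unfolding JJ[OF v(1)] scaleR_scaleC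
        by (intro complex_vector.span_neg complex_vector.span_scale) (fact \<open>v \<in> ?span ?B\<close>)
      ultimately show ?thesis
        unfolding x_eq add scale
        by (intro complex_vector.span_add complex_vector.span_scale)
    qed
    ultimately have "Q (n + 2)"
      unfolding Q_def using B JE v(1) card by (intro exI[of _ ?B]) auto
    with max show False by fastforce
  qed
  with B(2) have "complex_vector.dim E = card B"
    using B(3) by (intro complex_vector.dim_unique[of B]) auto
  with B(4) show ?thesis by simp
qed

text \<open>The squared norm of \<open>w\<close> is \<open>1 - l\<close> times that of
  \<open>v\<close>, so \<open>w\<close> vanishes at \<open>l = 1\<close>; hence the restriction
  \<open>l \<noteq> 1\<close>. The clause \<open>w \<noteq> v\<close> is separate because
  \<open>{v, w}\<close> would otherwise collapse to a singleton. Under \<open>finite_cdim\<close>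
  the value of \<open>dim\<close> is the genuine dimension and not the default 0 of the infinite
  case.\<close>

theorem proposition6:
  fixes C :: "'h::chilbert_space \<Rightarrow> 'h"
    and C0 :: "'k::chilbert_space \<Rightarrow> 'k"
    and S \<Sigma> P F T :: "'h \<Rightarrow> 'h"
    and \<Phi> :: "'k \<Rightarrow> 'h"
    and T0 :: "'k \<Rightarrow> 'k"
    and \<eta> :: real
  assumes "complex_conjugation C"
    and "complex_conjugation C0"
    and "\<eta> \<in> {- 1, 1}"
    and "symmetry_op C S" and "symmetry_op C \<Sigma>" and "S \<circ> \<Sigma> = \<Sigma> \<circ> S"
    and "S \<circ> S = (\<lambda>x. \<eta> *\<^sub>R x)" and "\<Sigma> \<circ> \<Sigma> = (\<lambda>x. - \<eta> *\<^sub>R x)"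
    and "orthogonal_projection P"
    and "cadjoint S \<circ> op_conj C C P \<circ> S = (\<lambda>x. x - P x)"
    and "\<Sigma> \<circ> P = P \<circ> \<Sigma>"
    and "unitary_op F"
    and "cadjoint \<Sigma> \<circ> op_transpose C C F \<circ> \<Sigma> = F"
    and "S \<circ> F = F \<circ> S"
    and T_def: "T = (\<lambda>x. P (F (P x)) + (x - P x))"
    and "fredholm T"
    and "lagrangian_frame C0 C S \<Phi>"
    and "P = \<Phi> \<circ> cadjoint \<Phi>"
    and T0_def: "T0 = cadjoint \<Phi> \<circ> T \<circ> \<Phi>"
  shows "T0 = cadjoint \<Phi> \<circ> F \<circ> \<Phi> \<and> bounded_clinear T0 \<and>
    (\<forall>(l::real) v. 0 \<le> l \<and> v \<noteq> 0 \<and> cadjoint T0 (T0 v) = complex_of_real l *\<^sub>C v \<longrightarrow>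
       (let w = C0 (cadjoint (S \<circ> op_conj C0 C \<Phi>) (cadjoint \<Sigma> (F (\<Phi> v))))
        in cadjoint T0 (T0 w) = complex_of_real l *\<^sub>C w \<and>
           (l \<noteq> 1 \<longrightarrow> w \<noteq> v \<and> complex_vector.independent {v, w}))) \<and>
    (\<forall>\<mu>. \<mu> \<noteq> 1 \<and> (\<exists>v. v \<noteq> 0 \<and> cadjoint T0 (T0 v) = \<mu> *\<^sub>C v) \<and>
         finite_cdim (eigenspace (cadjoint T0 \<circ> T0) \<mu>) \<longrightarrow>
       even (complex_vector.dim (eigenspace (cadjoint T0 \<circ> T0) \<mu>)))"
proof -

  \<comment> \<open>Operator identities from the hypotheses\<close>
  have bS: "bounded_clinear S" and b\<Sigma>: "bounded_clinear \<Sigma>" and bF: "bounded_clinear F"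
    and b\<Phi>: "bounded_clinear \<Phi>"
    using assms by (simp_all add: symmetry_op_def unitary_op_def lagrangian_frame_def)
  define \<Psi> where "\<Psi> = S \<circ> op_conj C0 C \<Phi>"
  have b\<Psi>: "bounded_clinear \<Psi>"
    unfolding \<Psi>_def
    by (intro bounded_clinear_compose bounded_clinear_op_conj bS b\<Phi> assms(1,2))
  note bounded = bS b\<Sigma> bF b\<Phi> b\<Psi> bounded_clinear_cadjoint
  have CC: "C (C x) = x" for x
    using assms(1) unfolding complex_conjugation_def by (metis comp_apply id_apply)
  have C0_add: "C0 (x + y) = C0 x + C0 y" and C0_scale: "C0 (a *\<^sub>C x) = cnj a *\<^sub>C C0 x"
    and C0C0: "C0 (C0 x) = x" for x y a
    using assms(2) unfolding complex_conjugation_def by (metis comp_apply id_apply)+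
  have C_real: "C (S x) = S (C x)" "C (\<Sigma> x) = \<Sigma> (C x)" for x
    using assms(4,5) CC unfolding symmetry_op_def op_conj_def by (metis comp_apply)+
  have SF: "S (F x) = F (S x)" and S\<Sigma>: "S (\<Sigma> x) = \<Sigma> (S x)"
    and \<Sigma>P: "\<Sigma> (P x) = P (\<Sigma> x)"
    and SS: "S (S x) = \<eta> *\<^sub>R x" and \<Sigma>\<Sigma>: "\<Sigma> (\<Sigma> x) = - \<eta> *\<^sub>R x" for x
    using assms(6-8,11,14) by (metis comp_apply)+
  have unitary: "unitary_op S" "unitary_op \<Sigma>" "unitary_op F"
    using assms by (simp_all add: symmetry_op_def)
  have \<Sigma>adj: "cadjoint \<Sigma> (\<Sigma> x) = x" "\<Sigma> (cadjoint \<Sigma> x) = x" for x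
    using unitary(2) unfolding unitary_op_def by (metis comp_apply id_apply)+
  have \<Phi>adj: "cadjoint \<Phi> (\<Phi> x) = x" for x
    using assms(17) unfolding lagrangian_frame_def by (metis comp_apply id_apply)
  have P: "P x = \<Phi> (cadjoint \<Phi> x)" for x
    by (simp add: assms(18))
  \<comment> \<open>The second frame is an isometric copy onto the complement: its range projection
    is \<open>1 - P\<close>.\<close>
  have \<Psi>\<Psi>: "\<Psi> (cadjoint \<Psi> x) = x - P x" for x
    using assms(17) unfolding lagrangian_frame_def \<Psi>_def P by (metis add_diff_cancel_left')
  have F_transpose: "cadjoint (op_conj C C F) (\<Sigma> x) = \<Sigma> (F x)" for x
    using assms(13) \<Sigma>adj unfolding op_transpose_def by (metis comp_apply)
  \<comment> \<open>\<open>P\<close> fixes the range of \<open>\<Phi>\<close>, so the summand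
    \<open>x - P x\<close> of \<open>T\<close> vanishes there, and the outer \<open>P\<close> is
    absorbed by \<open>cadjoint \<Phi>\<close>.\<close>
  have T0: "T0 x = cadjoint \<Phi> (F (\<Phi> x))" for x
    by (simp add: T0_def T_def P \<Phi>adj)
  then have T0_eq: "T0 = cadjoint \<Phi> \<circ> F \<circ> \<Phi>"
    by auto
  have bT0: "bounded_clinear T0"
    unfolding T0_eq by (intro bounded_clinear_compose bounded)

  \<comment> \<open>The antilinear partner map\<close>
  define A where "A x = cadjoint \<Psi> (cadjoint \<Sigma> (F (\<Phi> x)))" for x
  have bA: "bounded_clinear A"
  proof -
    have "A = cadjoint \<Psi> \<circ> cadjoint \<Sigma> \<circ> F \<circ> \<Phi>"
      by (auto simp: A_def)
    then show ?thesis
      by (simp only:) (intro bounded_clinear_compose bounded)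
  qed
  \<comment> \<open>\<open>J v\<close> is the vector \<open>w\<close> of the theorem; its linear
    factor \<open>A\<close> is kept apart so that adjoints and boundedness apply.\<close>
  define J where "J x = C0 (A x)" for x
  have J_add: "J (x + y) = J x + J y" and J_scale: "J (a *\<^sub>C x) = cnj a *\<^sub>C J x" for x y a
    by (simp_all add: J_def bA bounded_clinear_add bounded_clinear_scaleC C0_add C0_scale)
  have J_form: "cinner x (J y) = cinner (F (\<Phi> y)) (\<Sigma> (S (C (\<Phi> x))))" for x y
  proof -
    have "cinner x (J y) = cinner (A y) (C0 x)"
      using cinner_complex_conjugation[OF assms(2), of "C0 x" "A y"] by (simp add: J_def C0C0)
    then show ?thesis
      by (simp add: A_def cinner_cadjoint_left bounded \<Psi>_def[symmetric])
        (simp add: \<Psi>_def op_conj_def C0C0)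
  qed
  \<comment> \<open>Inserting \<open>\<Sigma>\<close> on both sides contributes
    \<open>- \<eta>\<close> and lets \<open>F\<close> move across by its transpose symmetry;
    inserting \<open>S\<close> on both sides contributes \<open>\<eta>\<close>. The product
    \<open>- \<eta> * \<eta> = - 1\<close> is the sign, and conjugation by \<open>C\<close> restores
    the original form with \<open>x\<close> and \<open>y\<close> swapped.\<close>
  have J_skew: "cinner x (J y) = - cinner y (J x)" for x y
  proof -
    have "cinner x (J y) = cinner (\<Sigma> (F (\<Phi> y))) (\<Sigma> (\<Sigma> (S (C (\<Phi> x)))))"
      by (simp add: J_form cinner_unitary unitary)
    also have "\<dots> = - \<eta> * cinner (cadjoint (op_conj C C F) (\<Sigma> (\<Phi> y))) (S (C (\<Phi> x)))"
      by (simp add: F_transpose \<Sigma>\<Sigma> cinner_minus_right cinner_scaleR_right)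
    also have "\<dots> = - \<eta> * cinner (\<Sigma> (\<Phi> y)) (C (F (S (\<Phi> x))))"
      by (subst cinner_cadjoint_left[OF bounded_clinear_op_conj[OF assms(1,1) bF]])
        (simp add: op_conj_def CC flip: C_real(1))
    also have "\<dots> = - cinner (\<Sigma> (\<Phi> y)) (\<eta> *\<^sub>R S (C (F (\<Phi> x))))"
      by (simp add: C_real SF[symmetric] cinner_scaleR_right)
    also have "\<dots> = - cinner (S (\<Sigma> (\<Phi> y))) (\<eta> *\<^sub>R S (S (C (F (\<Phi> x)))))"
      by (simp add: cinner_unitary unitary cinner_scaleR_right)
    also have "\<dots> = - cinner (\<Sigma> (S (\<Phi> y))) (C (F (\<Phi> x)))"
      using assms(3) by (auto simp: SS S\<Sigma>)
    also have "\<dots> = - cinner y (J x)"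
      using cinner_complex_conjugation[OF assms(1), of "\<Sigma> (S (C (\<Phi> y)))" "F (\<Phi> x)"]
      by (simp add: J_form C_real CC)
    finally show ?thesis .
  qed

  \<comment> \<open>The square of the partner map\<close>
  have A_form: "cinner (A x) (A y) = cinner x y - cinner (T0 x) (T0 y)" for x y
  proof -
    have P\<Sigma>: "P (cadjoint \<Sigma> u) = cadjoint \<Sigma> (P u)" for u
      by (metis \<Sigma>P \<Sigma>adj)
    have "cinner (A x) (A y) =
        cinner (cadjoint \<Sigma> (F (\<Phi> x))) (cadjoint \<Sigma> (F (\<Phi> y) - P (F (\<Phi> y))))"
      by (simp add: A_def cinner_cadjoint_left bounded \<Psi>\<Psi> P\<Sigma> bounded_clinear_diff)
    also have "\<dots> = cinner (F (\<Phi> x)) (F (\<Phi> y) - P (F (\<Phi> y)))"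
      by (simp add: cinner_cadjoint_left bounded \<Sigma>adj)
    also have "\<dots> = cinner (\<Phi> x) (\<Phi> y) - cinner (T0 x) (T0 y)"
      by (simp add: cinner_diff_right cinner_unitary unitary cinner_cadjoint_left bounded T0 P)
    also have "cinner (\<Phi> x) (\<Phi> y) = cinner x y"
      by (simp add: cinner_cadjoint_right b\<Phi> \<Phi>adj)
    finally show ?thesis .
  qed
  \<comment> \<open>Skewness gives minus the inner product of \<open>J x\<close> and
    \<open>J y\<close>, and \<open>C0\<close> swaps its arguments to leave
    \<open>- cinner (A y) (A x)\<close>, which \<open>A_form\<close> evaluates.\<close>
  have JJ: "J (J x) = cadjoint T0 (T0 x) - x" for x
  proof (rule cinner_eqI)
    fix y
    have "cinner y (J (J x)) = - cinner (A y) (A x)"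
      using J_skew[of y "J x"] cinner_complex_conjugation[OF assms(2), of "A x" "A y"]
      by (simp add: J_def)
    then show "cinner y (J (J x)) = cinner y (cadjoint T0 (T0 x) - x)"
      by (simp add: A_form cinner_diff_right cinner_cadjoint_right bT0)
  qed
  have M: "cadjoint T0 (T0 x) = x + J (J x)" for x
    by (simp add: JJ)

  \<comment> \<open>Partner eigenvectors and even degeneracy\<close>
  have J_eigen: "cadjoint T0 (T0 (J v)) = cnj \<mu> *\<^sub>C J v"
    if "cadjoint T0 (T0 v) = \<mu> *\<^sub>C v" for v \<mu>
    using that by (simp add: M flip: J_add J_scale)
  \<comment> \<open>The eigenvalue is a quotient of squared norms, hence real, and positivity of
    \<open>cinner (A v) (A v)\<close> bounds it by 1.\<close>
  have eigenvalue: "\<mu> \<in> \<real> \<and> Re \<mu> \<le> 1"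
    if v: "v \<noteq> 0" "cadjoint T0 (T0 v) = \<mu> *\<^sub>C v" for v \<mu>
  proof -
    have "complex_of_real ((norm (T0 v))\<^sup>2) = \<mu> * complex_of_real ((norm v)\<^sup>2)"
      using v(2) by (simp add: norm_sq_cinner cinner_cadjoint_right bT0 cinner_scaleC_right
          del: of_real_power)
    then have \<mu>: "\<mu> = complex_of_real ((norm (T0 v))\<^sup>2 / (norm v)\<^sup>2)"
      using v(1) by (simp add: field_simps)
    have "(norm (T0 v))\<^sup>2 \<le> (norm v)\<^sup>2"
      using arg_cong[OF A_form[of v v], of Re] zero_le_power2[of "norm (A v)"]
      unfolding minus_complex.sel Re_cinner_self by linarith
    then have "Re \<mu> \<le> 1"
      using v(1) unfolding \<mu> by simp
    then show ?thesis using \<mu> by (metis Reals_of_real)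
  qed
  have JJ_eigen: "J (J v) = - ((1 - l) *\<^sub>R v)"
    if "cadjoint T0 (T0 v) = complex_of_real l *\<^sub>C v" for v l
    using that by (simp add: JJ scaleR_left_diff_distrib flip: scaleR_scaleC)
  have partner: "cadjoint T0 (T0 (J v)) = complex_of_real l *\<^sub>C J v \<and>
      (l \<noteq> 1 \<longrightarrow> J v \<noteq> v \<and> complex_vector.independent {v, J v})"
    if v: "v \<noteq> 0" "cadjoint T0 (T0 v) = complex_of_real l *\<^sub>C v" for l v
  proof (intro conjI impI)
    show "cadjoint T0 (T0 (J v)) = complex_of_real l *\<^sub>C J v"
      using J_eigen[OF v(2)] by simp
    assume "l \<noteq> 1"
    then have l: "0 < 1 - l"
      using eigenvalue[OF v] by simp
    have ne: "J v \<noteq> a *\<^sub>C v" for a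
      by (rule antilinear_square_no_eigenvector[where c = "1 - l"])
        (use J_scale JJ_eigen v l in auto)
    show "J v \<noteq> v"
      using ne[of 1] by (simp add: scaleC_one)
    have "J v \<notin> complex_vector.span {v}"
      using ne by (auto simp: complex_vector.span_singleton)
    moreover have "complex_vector.independent {v}"
      using v(1) by (simp add: complex_vector.dependent_single)
    ultimately have "complex_vector.independent {J v, v}"
      by (rule complex_vector.independent_insertI)
    then show "complex_vector.independent {v, J v}"
      by (simp add: insert_commute)
  qed
  have degeneracy: "even (complex_vector.dim (eigenspace (cadjoint T0 \<circ> T0) \<mu>))"
    if "\<mu> \<noteq> 1" and v: "v \<noteq> 0" "cadjoint T0 (T0 v) = \<mu> *\<^sub>C v"
      and fin: "finite_cdim (eigenspace (cadjoint T0 \<circ> T0) \<mu>)" for \<mu> v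
  proof -
    \<comment> \<open>Since the eigenvalue is real, the conjugation in \<open>J_eigen\<close>
      disappears and \<open>J\<close> preserves the eigenspace, with square
      \<open>- (1 - l)\<close>.\<close>
    obtain l where \<mu>: "\<mu> = complex_of_real l"
      using eigenvalue[OF v] by (auto elim: Reals_cases)
    have l: "0 < 1 - l"
      using eigenvalue[OF v] \<open>\<mu> \<noteq> 1\<close> by (auto simp: \<mu>)
    have "bounded_clinear (cadjoint T0 \<circ> T0)"
      by (intro bounded_clinear_compose bounded_clinear_cadjoint bT0)
    then have "complex_vector.subspace (eigenspace (cadjoint T0 \<circ> T0) \<mu>)"
      by (rule subspace_eigenspace)
    then show ?thesis
      by (rule even_dim_if_quaternionic[OF J_add J_scale _ fin _ _ l])
        (auto simp: eigenspace_def \<mu> JJ_eigen J_eigen[where \<mu> = "complex_of_real l", simplified])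
  qed
  have w: "C0 (cadjoint (S \<circ> op_conj C0 C \<Phi>) (cadjoint \<Sigma> (F (\<Phi> v)))) = J v" for v
    by (simp add: J_def A_def \<Psi>_def)
  show ?thesis
    unfolding Let_def w
  proof (intro conjI allI impI)
    show "T0 = cadjoint \<Phi> \<circ> F \<circ> \<Phi>" "bounded_clinear T0"
      by (fact T0_eq bT0)+
  qed (use partner degeneracy in auto)
qed

end
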